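(* Let $\mathcal{A}_1,\dots,\mathcal{A}_d\in\mathbb{R}^{n_1\times n_2\times n_3}$ be linearly independent, let $\mathscr{A}(\mathcal{T})=(\langle\mathcal{A}_1,\mathcal{T}\rangle,\dots,\langle\mathcal{A}_d,\mathcal{T}\rangle)\in\mathbb{R}^d$, let $\mathbf{b}\in\mathbb{R}^d$, and assume $\{\mathcal{T}:\mathscr{A}(\mathcal{T})=\mathbf{b}\}\ne\emptyset$. Let $\Upsilon=\{\mathbf{x}_1,\dots,\mathbf{x}_m\}\subseteq\mathbb{B}^{n_1}$ be a finite set. With the problems PRIMAL, PRIMAL(D), DUAL and DUAL(D) defined in the context (PRIMAL(D) and DUAL(D) being formed with this $\Upsilon$): (i) DUAL(D) is the Lagrangian dual problem of PRIMAL(D), and strong duality holds between them, i.e. $\mathrm{val}(\text{PRIMAL(D)})=\mathrm{val}(\text{DUAL(D)})$. (ii) $\mathrm{val}(\text{DUAL})=\mathrm{val}(\text{DUAL(D)})$ if and only if there exists an optimal solution $(\mathcal{T}^*,\Theta^*,\Lambda^* )$ of PRIMAL such that $\Upsilon=\Theta^*$.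
   Context: $\mathbb{B}^{n}=\{\mathbf{x}\in\mathbb{R}^n:\|\mathbf{x}\|=1\}$; $\langle\cdot,\cdot\rangle$ is the entrywise (Frobenius) inner product; $(\mathbf{x}\otimes\Gamma)(j_1,j_2,j_3)=x_{j_1}\Gamma(j_2,j_3)$. For $\mathcal{Z}\in\mathbb{R}^{n_1\times n_2\times n_3}$ with first-mode slices $\mathbf{Z}_j\in\mathbb{R}^{n_2\times n_3}$, $\mathcal{Z}(\mathbf{x})=\sum_{j=1}^{n_1}x_j\mathbf{Z}_j$. $\mathrm{val}(\cdot)$ denotes the optimal value of a problem (in the extended reals; the infimum over an empty feasible set is $+\infty$). PRIMAL: minimize $\frac12\sum_{\mathbf{x}\in\Theta}\operatorname{tr}(\Lambda(\mathbf{x}))$ over tensors $\mathcal{T}\in\mathbb{R}^{n_1\times n_2\times n_3}$, finite sets $\Theta\subseteq\mathbb{B}^{n_1}$, and families $(\Lambda(\mathbf{x}))_{\mathbf{x}\in\Theta}$ of symmetric matrices, subject to $$\Lambda(\mathbf{x})=\begin{bmatrix}\Lambda^{(1)}(\mathbf{x})&\Gamma(\mathbf{x})\\ \Gamma(\mathbf{x})^\top&\Lambda^{(2)}(\mathbf{x})\end{bmatrix}\succeq0\ \ \forall\mathbf{x}\in\Theta,\qquad \mathcal{T}=\sum_{\mathbf{x}\in\Theta}\mathbf{x}\otimes\Gamma(\mathbf{x}),\qquad \mathscr{A}(\mathcal{T})=\mathbf{b},$$ with blocks $\Lambda^{(1)}(\mathbf{x})\in\mathbb{R}^{n_2\times n_2}$,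 $\Gamma(\mathbf{x})\in\mathbb{R}^{n_2\times n_3}$, $\Lambda^{(2)}(\mathbf{x})\in\mathbb{R}^{n_3\times n_3}$. PRIMAL(D): the same problem with $\Theta$ fixed to $\Upsilon$, i.e. minimize $\frac12\sum_{i=1}^m\operatorname{tr}(\Lambda_i)$ over $\mathcal{T},\Lambda_1,\dots,\Lambda_m$ subject to $\Lambda_i=\begin{bmatrix}\Lambda_i^{(1)}&\Gamma_i\\ \Gamma_i^\top&\Lambda_i^{(2)}\end{bmatrix}\succeq0$ for $i=1,\dots,m$, $\mathcal{T}=\sum_{i=1}^m\mathbf{x}_i\otimes\Gamma_i$, and $\mathscr{A}(\mathcal{T})=\mathbf{b}$. DUAL: maximize $\boldsymbol\lambda^\top\mathbf{b}$ over $\boldsymbol\lambda\in\mathbb{R}^d$, $\mathcal{Z}\in\mathbb{R}^{n_1\times n_2\times n_3}$ subject to $$\begin{bmatrix}\mathbf{I}_{n_2}&\mathcal{Z}(\mathbf{x})\\ \mathcal{Z}(\mathbf{x})^\top&\mathbf{I}_{n_3}\end{bmatrix}\succeq0\ \ \forall\mathbf{x}\in\mathbb{B}^{n_1},\qquad \mathcal{Z}=\sum_{\ell=1}^d\lambda_\ell\mathcal{A}_\ell.$$ DUAL(D): the same as DUAL except that the semidefinite constraint is imposed only for $\mathbf{x}\in\Upsilon$. *)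

theory Defs
  imports "HOL-Analysis.Analysis"
begin

(* A tensor in R^(n1 x n2 x n3) has type real^'n3^'n2^'n1, with entries T $ j1 $ j2 $ j3
   and first-mode slices T $ j1 :: real^'n3^'n2 (n2 rows, n3 columns).  On matrices and tensors
   the inner product of nested vectors is the entrywise (Frobenius) one. *)

definition psd :: "real^'k^'k \<Rightarrow> bool" where
  "psd M \<longleftrightarrow> transpose M = M \<and> (\<forall>v. 0 \<le> v \<bullet> (M *v v))"

definition block_matrix ::
  "real^'p^'p \<Rightarrow> real^'q^'p \<Rightarrow> real^'p^'q \<Rightarrow> real^'q^'q \<Rightarrow> real^('p + 'q)^('p + 'q)" where
  "block_matrix P Q R S =
     (\<chi> i j. case i of
        Inl a \<Rightarrow> (case j of Inl b \<Rightarrow> P $ a $ b | Inr b \<Rightarrow> Q $ a $ b)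
      | Inr a \<Rightarrow> (case j of Inl b \<Rightarrow> R $ a $ b | Inr b \<Rightarrow> S $ a $ b))"

(* Upper right block.  A symmetric M is
   [L1, upper_right M; transpose (upper_right M), L2] for its diagonal blocks L1 and L2. *)
definition upper_right :: "real^('p + 'q)^('p + 'q) \<Rightarrow> real^'q^'p" where
  "upper_right M = (\<chi> i j. M $ Inl i $ Inr j)"

definition outer_tensor :: "real^'n1 \<Rightarrow> real^'n3^'n2 \<Rightarrow> real^'n3^'n2^'n1" where
  "outer_tensor x G = (\<chi> j1 j2 j3. x $ j1 * G $ j2 $ j3)"

definition slice_comb :: "real^'n3^'n2^'n1 \<Rightarrow> real^'n1 \<Rightarrow> real^'n3^'n2" where
  "slice_comb Z x = (\<Sum>j\<in>UNIV. x $ j *\<^sub>R Z $ j)"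

definition measure_op ::
  "('d \<Rightarrow> real^'n3^'n2^'n1) \<Rightarrow> real^'n3^'n2^'n1 \<Rightarrow> real^'d" where
  "measure_op A T = (\<chi> l. A l \<bullet> T)"

(* A family of matrices indexed by a finite set of points x is a function of x; the values of
   the function outside the set play no role in any of the problems. *)

definition half_trace_sum :: "'x set \<Rightarrow> ('x \<Rightarrow> real^'k^'k) \<Rightarrow> real" where
  "half_trace_sum \<Theta> \<Lambda> = (1/2) * (\<Sum>x\<in>\<Theta>. trace (\<Lambda> x))"

definition primal_D_feasible ::
  "('d \<Rightarrow> real^'n3^'n2^'n1) \<Rightarrow> real^'d \<Rightarrow> (real^'n1) set \<Rightarrow>
   ((real^'n3^'n2^'n1) \<times> (real^'n1 \<Rightarrow> real^('n2 + 'n3)^('n2 + 'n3))) set" where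
  "primal_D_feasible A b \<Upsilon> = {(T, \<Lambda>).
     (\<forall>x\<in>\<Upsilon>. psd (\<Lambda> x)) \<and>
     T = (\<Sum>x\<in>\<Upsilon>. outer_tensor x (upper_right (\<Lambda> x))) \<and>
     measure_op A T = b}"

definition primal_D_val ::
  "('d \<Rightarrow> real^'n3^'n2^'n1) \<Rightarrow> real^'d \<Rightarrow> (real^'n1) set \<Rightarrow> ereal" where
  "primal_D_val A b \<Upsilon> =
     (INF (T, \<Lambda>) \<in> primal_D_feasible A b \<Upsilon>. ereal (half_trace_sum \<Upsilon> \<Lambda>))"

definition primal_feasible ::
  "('d \<Rightarrow> real^'n3^'n2^'n1) \<Rightarrow> real^'d \<Rightarrow>
   ((real^'n3^'n2^'n1) \<times> (real^'n1) set \<times>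
     (real^'n1 \<Rightarrow> real^('n2 + 'n3)^('n2 + 'n3))) set" where
  "primal_feasible A b = {(T, \<Theta>, \<Lambda>).
     finite \<Theta> \<and> \<Theta> \<subseteq> sphere 0 1 \<and>
     (\<forall>x\<in>\<Theta>. psd (\<Lambda> x)) \<and>
     T = (\<Sum>x\<in>\<Theta>. outer_tensor x (upper_right (\<Lambda> x))) \<and>
     measure_op A T = b}"

definition primal_optimal ::
  "('d \<Rightarrow> real^'n3^'n2^'n1) \<Rightarrow> real^'d \<Rightarrow>
   (real^'n3^'n2^'n1) \<times> (real^'n1) set \<times>
     (real^'n1 \<Rightarrow> real^('n2 + 'n3)^('n2 + 'n3)) \<Rightarrow> bool" where
  "primal_optimal A b =
     is_arg_min (\<lambda>(T, \<Theta>, \<Lambda>). half_trace_sum \<Theta> \<Lambda>) (\<lambda>s. s \<in> primal_feasible A b)"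

(* The multiplier vector lambda is written \<mu>.
   DUAL is the case X = sphere 0 1 and DUAL(D) the case X = \<Upsilon>. *)
definition dual_feasible ::
  "('d \<Rightarrow> real^'n3^'n2^'n1) \<Rightarrow> (real^'n1) set \<Rightarrow> ((real^'d) \<times> (real^'n3^'n2^'n1)) set" where
  "dual_feasible A X = {(\<mu>, Z).
     (\<forall>x\<in>X. psd (block_matrix (mat 1) (slice_comb Z x) (transpose (slice_comb Z x)) (mat 1))) \<and>
     Z = (\<Sum>l\<in>UNIV. \<mu> $ l *\<^sub>R A l)}"

definition dual_val ::
  "('d \<Rightarrow> real^'n3^'n2^'n1) \<Rightarrow> real^'d \<Rightarrow> (real^'n1) set \<Rightarrow> ereal" where
  "dual_val A b X = (SUP (\<mu>, Z) \<in> dual_feasible A X. ereal (\<mu> \<bullet> b))"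

(* Lagrangian of PRIMAL(D): \<mu> is the multiplier of b - measure_op A T = 0, Z that of
   T - (sum of outer tensors) = 0, and S x that of the cone constraint psd (\<Lambda> x).
   The cone of psd matrices is self-dual, so dual feasibility of S means psd (S x). *)
definition lagrangian_D ::
  "('d \<Rightarrow> real^'n3^'n2^'n1) \<Rightarrow> real^'d \<Rightarrow> (real^'n1) set \<Rightarrow>
   real^'n3^'n2^'n1 \<Rightarrow> (real^'n1 \<Rightarrow> real^('n2 + 'n3)^('n2 + 'n3)) \<Rightarrow>
   real^'d \<Rightarrow> real^'n3^'n2^'n1 \<Rightarrow> (real^'n1 \<Rightarrow> real^('n2 + 'n3)^('n2 + 'n3)) \<Rightarrow> real" where
  "lagrangian_D A b \<Upsilon> T \<Lambda> \<mu> Z S =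
     half_trace_sum \<Upsilon> \<Lambda>
     + \<mu> \<bullet> (b - measure_op A T)
     + Z \<bullet> (T - (\<Sum>x\<in>\<Upsilon>. outer_tensor x (upper_right (\<Lambda> x))))
     - (\<Sum>x\<in>\<Upsilon>. S x \<bullet> \<Lambda> x)"

definition lagrange_dual_fun_D ::
  "('d \<Rightarrow> real^'n3^'n2^'n1) \<Rightarrow> real^'d \<Rightarrow> (real^'n1) set \<Rightarrow>
   real^'d \<Rightarrow> real^'n3^'n2^'n1 \<Rightarrow> (real^'n1 \<Rightarrow> real^('n2 + 'n3)^('n2 + 'n3)) \<Rightarrow> ereal" where
  "lagrange_dual_fun_D A b \<Upsilon> \<mu> Z S =
     (INF (T, \<Lambda>) \<in> {(T, \<Lambda>). \<forall>x\<in>\<Upsilon>. transpose (\<Lambda> x) = \<Lambda> x}.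
        ereal (lagrangian_D A b \<Upsilon> T \<Lambda> \<mu> Z S))"

(* Multipliers satisfying the conic sign constraint at which the dual function is not -\<infinity>,
   i.e. the feasible set of the Lagrangian dual with its implicit constraints made explicit. *)
definition lagrange_dual_feasible_D ::
  "('d \<Rightarrow> real^'n3^'n2^'n1) \<Rightarrow> real^'d \<Rightarrow> (real^'n1) set \<Rightarrow>
   ((real^'d) \<times> (real^'n3^'n2^'n1) \<times> (real^'n1 \<Rightarrow> real^('n2 + 'n3)^('n2 + 'n3))) set" where
  "lagrange_dual_feasible_D A b \<Upsilon> = {(\<mu>, Z, S).
     (\<forall>x\<in>\<Upsilon>. psd (S x)) \<and> lagrange_dual_fun_D A b \<Upsilon> \<mu> Z S \<noteq> -\<infinity>}"

(* DUAL(D) carries only the variables (\<mu>, Z): its feasible set is the projection of that of the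
   Lagrangian dual (S is eliminated), and on it the dual function is the objective of DUAL(D). *)
definition dual_D_is_lagrangian_dual ::
  "('d \<Rightarrow> real^'n3^'n2^'n1) \<Rightarrow> real^'d \<Rightarrow> (real^'n1) set \<Rightarrow> bool" where
  "dual_D_is_lagrangian_dual A b \<Upsilon> \<longleftrightarrow>
     dual_feasible A \<Upsilon> = (\<lambda>(\<mu>, Z, S). (\<mu>, Z)) ` lagrange_dual_feasible_D A b \<Upsilon> \<and>
     (\<forall>(\<mu>, Z, S) \<in> lagrange_dual_feasible_D A b \<Upsilon>.
        lagrange_dual_fun_D A b \<Upsilon> \<mu> Z S = ereal (\<mu> \<bullet> b))"

end

theory Submission
  imports Defs
begin

text \<open>Dual feasibility on \<open>X\<close> says that \<open>\<mu>\<close> lies in the polar of the compact set of measurements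
  of tensors \<open>x \<otimes> u v\<^sup>T\<close> with \<open>x \<in> X\<close> and unit vectors \<open>u\<close>, \<open>v\<close>, while a point of the convex hull of
  this set is the measurement of a tensor of primal cost at most 1, via the rank-one matrices
  formed from the concatenation of \<open>u\<close> and \<open>v\<close>.  Separating \<open>b / t\<close> from that hull therefore yields
  strong duality, with primal attainment, for every compact \<open>X\<close>: both for \<open>\<Upsilon>\<close> and for the whole
  sphere.  The dual value on the sphere is finite, because the entries of a feasible \<open>Z\<close> are at
  most 1 in absolute value.  So PRIMAL is solved exactly at cost equal to the value of
  DUAL, and (ii) follows by comparing the two dual values.\<close>

section \<open>Positive semidefinite matrices\<close>

lemma sum_UNIV_Plus:
  "(\<Sum>i\<in>(UNIV :: ('p::finite + 'q::finite) set). f i) = (\<Sum>a\<in>UNIV. f (Inl a)) + (\<Sum>b\<in>UNIV. f (Inr b))"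
  by (subst UNIV_Plus_UNIV [symmetric], subst sum.Plus) (auto simp: o_def)

lemma inner_matrix: "(M :: real^'b::finite^'a::finite) \<bullet> N = (\<Sum>i\<in>UNIV. \<Sum>j\<in>UNIV. M $ i $ j * N $ i $ j)"
  by (simp add: inner_vec_def)

lemma inner_matrix_vector:
  "u \<bullet> ((M :: real^'b::finite^'a::finite) *v v) = (\<Sum>i\<in>UNIV. \<Sum>j\<in>UNIV. M $ i $ j * (u $ i * v $ j))"
  by (simp add: inner_vec_def matrix_vector_mult_def sum_distrib_left mult_ac)

definition rank_one :: "real^'k::finite \<Rightarrow> real^'k^'k" where
  "rank_one w = (\<chi> i j. w $ i * w $ j)"

text \<open>Turns quadratic forms into Frobenius products with rank-one matrices. Both the
  self-duality of the psd cone and the quadratic form of \<open>slack\<close> are read off through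
  it.\<close>

lemma inner_rank_one: "M \<bullet> rank_one w = w \<bullet> (M *v w)"
  by (simp only: inner_matrix inner_matrix_vector rank_one_def vec_lambda_beta)

lemma inner_rank_one_mult: "v \<bullet> (rank_one w *v v) = (v \<bullet> w)\<^sup>2"
proof -
  have "v \<bullet> (rank_one w *v v) = (\<Sum>i\<in>UNIV. \<Sum>j\<in>UNIV. (v $ i * w $ i) * (v $ j * w $ j))"
    by (simp only: inner_matrix_vector) (simp add: rank_one_def mult_ac)
  then show ?thesis by (simp add: power2_eq_square sum_product inner_vec_def)
qed

lemma trace_rank_one: "trace (rank_one w) = w \<bullet> w"
  by (simp add: trace_def rank_one_def inner_vec_def)

lemma psd_rank_one: "psd (rank_one w)"
  unfolding psd_def inner_rank_one_mult
  by (simp add: rank_one_def transpose_def vec_eq_iff mult.commute)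

lemma psd_zero: "psd 0"
  by (simp add: psd_def transpose_def vec_eq_iff)

lemma psd_add: "psd M \<Longrightarrow> psd N \<Longrightarrow> psd (M + N)"
  by (auto simp: psd_def transpose_def vec_eq_iff matrix_vector_mult_add_rdistrib inner_add_right)

lemma psd_scaleR: "psd M \<Longrightarrow> 0 \<le> c \<Longrightarrow> psd (c *\<^sub>R M)"
  by (auto simp: psd_def transpose_def vec_eq_iff scaleR_matrix_vector_assoc [symmetric])

text \<open>The form at \<open>v + t *\<^sub>R axis i 1\<close> as a polynomial in \<open>t\<close>.
  Taking \<open>v = 0\<close> gives the sign of the diagonal, a zero diagonal entry makes it affine
  in \<open>t\<close>, and minimising over \<open>t\<close> gives the Schur complement.\<close>

lemma psd_quadratic_shift:
  assumes "psd M"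
  shows "0 \<le> v \<bullet> (M *v v) + 2 * t * (M *v v) $ i + t\<^sup>2 * M $ i $ i"
proof -
  have sym: "transpose M = M" and pos: "0 \<le> (v + t *\<^sub>R axis i 1) \<bullet> (M *v (v + t *\<^sub>R axis i 1))"
    using assms by (auto simp: psd_def)
  have 1: "axis i 1 \<bullet> (M *v v) = (M *v v) $ i"
    by (simp add: inner_axis')
  have 2: "v \<bullet> (M *v axis i 1) = (M *v v) $ i"
    using 1 by (metis dot_lmul_matrix inner_commute sym transpose_matrix_vector)
  have 3: "axis i 1 \<bullet> (M *v axis i 1) = M $ i $ i"
    by (simp add: inner_axis' matrix_vector_mult_basis column_def)
  from pos show ?thesis
    by (simp add: matrix_vector_right_distrib matrix_vector_mult_scaleR inner_add_left
        inner_add_right 1 2 3 power2_eq_square algebra_simps)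
qed

lemma psd_diag_nonneg: "psd M \<Longrightarrow> 0 \<le> M $ i $ i"
  using psd_quadratic_shift [of M 0 1 i] by simp

lemma affine_nonneg_slope_zero:
  fixes a c :: real
  assumes "\<And>t. 0 \<le> a + t * c"
  shows "c = 0"
proof (rule ccontr)
  assume "c \<noteq> 0"
  \<comment> \<open>At this \<open>t\<close> the affine function equals -1.\<close>
  then show False using assms [of "- (a + 1) / c"] by simp
qed

text \<open>Without the term in \<open>t\<^sup>2\<close> the shifted form is affine and nonnegative
  for all \<open>t\<close>, so its slope \<open>2 * (M *v v) $ i\<close> vanishes for every
  \<open>v\<close>.\<close>

lemma psd_diag_zero:
  assumes "psd M" "M $ i $ i = 0"
  shows "M $ i $ j = 0" "M $ j $ i = 0"
proof -
  have z: "(M *v v) $ i = 0" for v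
    using affine_nonneg_slope_zero [of "v \<bullet> (M *v v)" "2 * (M *v v) $ i"]
      psd_quadratic_shift [OF assms(1), of v _ i] assms(2)
    by (simp add: mult_ac)
  show "M $ i $ j = 0"
    using z [of "axis j 1"] by (simp add: matrix_vector_mult_basis column_def)
  moreover have "M $ j $ i = transpose M $ i $ j" by (simp add: transpose_def)
  ultimately show "M $ j $ i = 0" using assms(1) by (simp add: psd_def)
qed

text \<open>Schur complement: subtracting this rank-one term clears row and column \<open>i\<close>.\<close>

lemma psd_deflate:
  assumes "psd M" "M $ i $ i \<noteq> 0"
  shows "psd (M - (1 / M $ i $ i) *\<^sub>R rank_one (column i M))"
proof -
  let ?m = "M $ i $ i" and ?w = "column i M"
  have sym: "transpose M = M" using assms(1) by (simp add: psd_def)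
  have m: "?m > 0" using psd_diag_nonneg [OF assms(1), of i] assms(2) by simp
  \<comment> \<open>By symmetry column \<open>i\<close> is also row \<open>i\<close>, so pairing
    with it computes a coordinate of \<open>M *v v\<close>.\<close>
  have "?w = M $ i"
    using row_transpose [of i M] unfolding sym by (simp add: row_def)
  then have w: "v \<bullet> ?w = (M *v v) $ i" for v
    by (simp add: matrix_vector_mul_component inner_commute)
  have "0 \<le> v \<bullet> ((M - (1 / ?m) *\<^sub>R rank_one ?w) *v v)" for v
  proof -
    have "v \<bullet> ((M - (1 / ?m) *\<^sub>R rank_one ?w) *v v) = v \<bullet> (M *v v) - ((M *v v) $ i)\<^sup>2 / ?m"
      by (simp add: matrix_vector_mult_diff_rdistrib inner_diff_right inner_rank_one_mult w
          scaleR_matrix_vector_assoc [symmetric])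
    \<comment> \<open>This is the shifted form at its minimiser
      \<open>t = - (M *v v) $ i / M $ i $ i\<close>.\<close>
    also have "\<dots> = v \<bullet> (M *v v) + 2 * (- (M *v v) $ i / ?m) * (M *v v) $ i + (- (M *v v) $ i / ?m)\<^sup>2 * ?m"
      using m by (simp add: field_simps power2_eq_square)
    also have "\<dots> \<ge> 0" by (rule psd_quadratic_shift [OF assms(1)])
    finally show ?thesis .
  qed
  moreover have "transpose (M - (1 / ?m) *\<^sub>R rank_one ?w) = M - (1 / ?m) *\<^sub>R rank_one ?w"
    using sym by (simp add: transpose_def vec_eq_iff rank_one_def mult_ac)
  ultimately show ?thesis by (simp add: psd_def)
qed

text \<open>Induction on the number of nonzero diagonal entries of \<open>M\<close>: each deflation
  splits off a positive multiple of a rank-one matrix, whose product with \<open>S\<close> is a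
  value of the quadratic form of \<open>S\<close>. This takes the place of a spectral
  decomposition.\<close>

lemma psd_inner_nonneg:
  assumes "psd S" "psd M"
  shows "0 \<le> S \<bullet> M"
  using assms(2)
proof (induction "card {i. M $ i $ i \<noteq> 0}" arbitrary: M rule: less_induct)
  case less
  show ?case
  proof (cases "\<forall>i. M $ i $ i = 0")
    case True
    then have "M $ i $ j = 0" for i j using psd_diag_zero(1) [OF less.prems] by blast
    then have "M = 0" by (simp add: vec_eq_iff)
    then show ?thesis by simp
  next
    case False
    then obtain i where i: "M $ i $ i \<noteq> 0" by blast
    define N where "N = M - (1 / M $ i $ i) *\<^sub>R rank_one (column i M)"
    have N: "psd N" unfolding N_def by (rule psd_deflate [OF less.prems i])
    have "N $ i $ i = 0" using i by (simp add: N_def rank_one_def column_def)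
    \<comment> \<open>Zero diagonal entries stay zero: row \<open>k\<close> of \<open>M\<close>
      vanishes, so \<open>column i M\<close> is 0 at \<open>k\<close>.\<close>
    moreover have "N $ k $ k = 0" if "M $ k $ k = 0" for k
      using psd_diag_zero [OF less.prems that] that by (simp add: N_def rank_one_def column_def)
    ultimately have "{i. N $ i $ i \<noteq> 0} \<subset> {i. M $ i $ i \<noteq> 0}" using i by blast
    then have "0 \<le> S \<bullet> N" using less.hyps [of N] N by (simp add: psubset_card_mono)
    moreover have "0 \<le> S \<bullet> rank_one (column i M) / M $ i $ i"
      using assms(1) psd_diag_nonneg [OF less.prems, of i] by (simp add: psd_def inner_rank_one)
    ultimately show ?thesis by (simp add: N_def inner_diff_right)
  qed
qed

section \<open>The semidefinite constraint of the dual\<close>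

text \<open>Stationarity of the Lagrangian forces the multiplier of \<open>psd (\<Lambda> x)\<close> to be
  \<open>slack (slice_comb Z x)\<close>.\<close>

definition slack :: "real^'q::finite^'p::finite \<Rightarrow> real^('p + 'q)^('p + 'q)" where
  "slack W = (1/2) *\<^sub>R block_matrix (mat 1) (- W) (- transpose W) (mat 1)"

lemma sum_mat_1: "(\<Sum>b\<in>UNIV. mat 1 $ a $ b * f b) = (f a :: real)"
proof -
  have "(\<Sum>b\<in>UNIV. mat 1 $ a $ b * f b) = (\<Sum>b\<in>UNIV. if a = b then f b else 0)"
    by (intro sum.cong) (auto simp: mat_def)
  then show ?thesis by simp
qed

text \<open>The two off-diagonal blocks contribute equally when \<open>L\<close> is symmetric, and
  the factor 1/2 in \<open>slack\<close> leaves one copy. Cost minus pairing thus becomes a product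
  of two matrices, nonnegative when both are psd.\<close>

lemma inner_slack:
  fixes W :: "real^'q::finite^'p::finite"
  assumes "transpose L = L"
  shows "slack W \<bullet> L = (1/2) * trace L - W \<bullet> upper_right L"
proof -
  have sym: "L $ Inr b $ Inl a = L $ Inl a $ Inr b" for a b
    using arg_cong [OF assms, of "\<lambda>M. M $ Inl a $ Inr b"] by (simp add: transpose_def)
  have "block_matrix (mat 1) (- W) (- transpose W) (mat 1) \<bullet> L =
      (\<Sum>a\<in>UNIV. L $ Inl a $ Inl a) - (\<Sum>a\<in>UNIV. \<Sum>b\<in>UNIV. W $ a $ b * L $ Inl a $ Inr b) +
      ((\<Sum>b\<in>UNIV. L $ Inr b $ Inr b) - (\<Sum>b\<in>UNIV. \<Sum>a\<in>UNIV. W $ a $ b * L $ Inl a $ Inr b))"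
    by (simp add: inner_matrix sum_UNIV_Plus block_matrix_def sum_mat_1 transpose_def sym
        sum.distrib sum_negf)
  also have "(\<Sum>b\<in>UNIV. \<Sum>a\<in>UNIV. W $ a $ b * L $ Inl a $ Inr b) =
      (\<Sum>a\<in>UNIV. \<Sum>b\<in>UNIV. W $ a $ b * L $ Inl a $ Inr b)"
    by (rule sum.swap)
  finally have "block_matrix (mat 1) (- W) (- transpose W) (mat 1) \<bullet> L = trace L - 2 * (W \<bullet> upper_right L)"
    by (simp add: trace_def sum_UNIV_Plus inner_matrix [of W] upper_right_def)
  then show ?thesis by (simp add: slack_def)
qed

lemma transpose_slack: "transpose (slack W) = slack W"
  unfolding vec_eq_iff
proof (intro allI)
  fix i j
  show "transpose (slack W) $ i $ j = slack W $ i $ j"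
    by (cases i; cases j) (auto simp: transpose_def slack_def block_matrix_def mat_def)
qed

lemma transpose_block_mat1:
  "transpose (block_matrix (mat 1) W (transpose W) (mat 1)) = block_matrix (mat 1) W (transpose W) (mat 1)"
  unfolding vec_eq_iff
proof (intro allI)
  fix i j
  show "transpose (block_matrix (mat 1) W (transpose W) (mat 1)) $ i $ j =
      block_matrix (mat 1) W (transpose W) (mat 1) $ i $ j"
    by (cases i; cases j) (auto simp: transpose_def block_matrix_def mat_def)
qed

section \<open>Quadratic forms on concatenated vectors\<close>

definition join :: "real^'p::finite \<Rightarrow> real^'q::finite \<Rightarrow> real^('p + 'q)" where
  "join u v = (\<chi> i. case i of Inl a \<Rightarrow> u $ a | Inr b \<Rightarrow> v $ b)"

lemma join_cases: obtains u v where "w = join u v"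
proof
  show "w = join (\<chi> a. w $ Inl a) (\<chi> b. w $ Inr b)"
    by (auto simp: join_def vec_eq_iff split: sum.split)
qed

lemma inner_join: "join u v \<bullet> join u' v' = u \<bullet> u' + v \<bullet> v'"
  by (simp add: join_def inner_vec_def sum_UNIV_Plus)

text \<open>Hence \<open>rank_one (join u v)\<close> is a psd lift of the matrix u v^T with half
  trace \<open>(1/2) * (u \<bullet> u + v \<bullet> v)\<close>, which is 1 for unit vectors.\<close>

lemma upper_right_rank_one_join: "upper_right (rank_one (join u v)) = (\<chi> i j. u $ i * v $ j)"
  by (simp add: upper_right_def rank_one_def join_def)

lemma inner_outer: "(W :: real^'q::finite^'p::finite) \<bullet> (\<chi> i j. u $ i * v $ j) = u \<bullet> (W *v v)"
  by (simp only: inner_matrix inner_matrix_vector vec_lambda_beta)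

lemma quadratic_slack:
  "join u v \<bullet> (slack W *v join u v) = (1/2) * (u \<bullet> u + v \<bullet> v) - u \<bullet> (W *v v)"
  unfolding inner_rank_one [symmetric]
  using psd_rank_one [of "join u v"]
  by (subst inner_slack)
    (simp_all add: psd_def trace_rank_one inner_join upper_right_rank_one_join inner_outer)

lemma quadratic_block:
  "join u v \<bullet> (block_matrix (mat 1) W (transpose W) (mat 1) *v join u v) =
    (u \<bullet> u + v \<bullet> v) + 2 * (u \<bullet> (W *v v))"
proof -
  have "- transpose (- W) = transpose W" by (simp add: transpose_def vec_eq_iff)
  then have "block_matrix (mat 1) W (transpose W) (mat 1) = 2 *\<^sub>R slack (- W)"
    by (simp add: slack_def)
  then have "join u v \<bullet> (block_matrix (mat 1) W (transpose W) (mat 1) *v join u v) =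
      2 * ((1/2) * (u \<bullet> u + v \<bullet> v) - u \<bullet> ((- W) *v v))"
    by (simp only: scaleR_matrix_vector_assoc [symmetric] inner_scaleR_right quadratic_slack)
  moreover have "u \<bullet> ((- W) *v v) = - (u \<bullet> (W *v v))"
    by (simp only: inner_matrix_vector) (simp add: sum_negf)
  ultimately show ?thesis by simp
qed

lemma psd_slack_iff: "psd (slack W) \<longleftrightarrow> (\<forall>u v. u \<bullet> (W *v v) \<le> (1/2) * (u \<bullet> u + v \<bullet> v))"
proof -
  have "psd (slack W) \<longleftrightarrow> (\<forall>u v. 0 \<le> join u v \<bullet> (slack W *v join u v))"
    unfolding psd_def transpose_slack by (metis join_cases)
  then show ?thesis by (simp add: quadratic_slack)
qed

text \<open>The two quadratic forms differ by a factor 2 and the sign of the mixed term; replacing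
  \<open>u\<close> by \<open>- u\<close> absorbs the sign.\<close>

lemma psd_block_iff_psd_slack:
  "psd (block_matrix (mat 1) W (transpose W) (mat 1)) \<longleftrightarrow> psd (slack W)"
proof -
  have "psd (block_matrix (mat 1) W (transpose W) (mat 1)) \<longleftrightarrow>
      (\<forall>u v. 0 \<le> (u \<bullet> u + v \<bullet> v) + 2 * (u \<bullet> (W *v v)))" (is "_ \<longleftrightarrow> ?Q")
    unfolding psd_def transpose_block_mat1 quadratic_block [symmetric] by (metis join_cases)
  also have "?Q \<longleftrightarrow> (\<forall>u v. u \<bullet> (W *v v) \<le> (1/2) * (u \<bullet> u + v \<bullet> v))"
  proof (intro iffI allI)
    fix u v
    assume ?Q
    then have "0 \<le> ((- u) \<bullet> (- u) + v \<bullet> v) + 2 * ((- u) \<bullet> (W *v v))" by blast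
    then show "u \<bullet> (W *v v) \<le> (1/2) * (u \<bullet> u + v \<bullet> v)" by simp
  next
    fix u v
    assume "\<forall>u v. u \<bullet> (W *v v) \<le> (1/2) * (u \<bullet> u + v \<bullet> v)"
    then have "(- u) \<bullet> (W *v v) \<le> (1/2) * ((- u) \<bullet> (- u) + v \<bullet> v)" by blast
    then show "0 \<le> (u \<bullet> u + v \<bullet> v) + 2 * (u \<bullet> (W *v v))" by simp
  qed
  finally show ?thesis by (simp add: psd_slack_iff)
qed

text \<open>Homogeneity extends the bound to \<open>norm u * norm v\<close>, and the
  arithmetic-geometric mean inequality finishes.\<close>

lemma psd_slack_if_bounded:
  assumes "\<And>u v. norm u = 1 \<Longrightarrow> norm v = 1 \<Longrightarrow> u \<bullet> (W *v v) \<le> 1"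
  shows "psd (slack W)"
  unfolding psd_slack_iff
proof (intro allI)
  fix u v
  show "u \<bullet> (W *v v) \<le> (1/2) * (u \<bullet> u + v \<bullet> v)"
  proof (cases "u = 0 \<or> v = 0")
    case True
    then show ?thesis by auto
  next
    case False
    then have "(u /\<^sub>R norm u) \<bullet> (W *v (v /\<^sub>R norm v)) \<le> 1" by (intro assms) auto
    then have "u \<bullet> (W *v v) \<le> norm u * norm v"
      using False by (simp add: matrix_vector_mult_scaleR field_simps)
    also have "\<dots> \<le> (1/2) * (u \<bullet> u + v \<bullet> v)"
      using sum_squares_bound [of "norm u" "norm v"] by (simp add: power2_norm_eq_inner)
    finally show ?thesis .
  qed
qed

text \<open>Tests the bilinear bound on \<open>axis i s\<close> and \<open>axis j 1\<close> with
  \<open>s\<close> equal to 1 and -1.\<close>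

lemma psd_slack_entry:
  assumes "psd (slack W)"
  shows "\<bar>W $ i $ j\<bar> \<le> 1"
proof -
  have "axis i s \<bullet> (W *v axis j 1) = s * W $ i $ j" for s :: real
    by (simp add: inner_axis' matrix_vector_mult_basis column_def)
  then have "s * W $ i $ j \<le> (1/2) * (s * s + 1)" for s
    using assms [unfolded psd_slack_iff, rule_format, of "axis i s" "axis j 1"]
    by (simp add: inner_axis_axis)
  from this [of 1] this [of "-1"] show ?thesis by simp
qed

text \<open>The maps \<open>\<lambda>Z. slice_comb Z x\<close> and \<open>outer_tensor x\<close> are
  adjoint, which is how the slices of the dual meet the blocks of the primal.\<close>

lemma inner_outer_tensor: "Z \<bullet> outer_tensor x G = slice_comb Z x \<bullet> G"
proof -
  have "Z \<bullet> outer_tensor x G = (\<Sum>j\<in>UNIV. x $ j * (Z $ j \<bullet> G))"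
    by (simp add: inner_vec_def outer_tensor_def sum_distrib_left mult_ac)
  then show ?thesis by (simp add: slice_comb_def inner_sum_left)
qed

text \<open>The combination of the \<open>A l\<close> is the adjoint of \<open>measure_op A\<close>,
  so the dual objective is \<open>Z \<bullet> T\<close> for any \<open>T\<close> measured as
  \<open>b\<close>.\<close>

lemma inner_multiplier_comb:
  "(\<Sum>l\<in>UNIV. \<mu> $ l *\<^sub>R A l) \<bullet> T = \<mu> \<bullet> measure_op (A :: 'd::finite \<Rightarrow> _) T"
  by (simp add: measure_op_def inner_sum_left inner_vec_def [of \<mu>])

lemma dual_feasible_iff:
  "(\<mu>, Z) \<in> dual_feasible A X \<longleftrightarrow>
    (\<forall>x\<in>X. psd (slack (slice_comb Z x))) \<and> Z = (\<Sum>l\<in>UNIV. \<mu> $ l *\<^sub>R A l)"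
  by (simp add: dual_feasible_def psd_block_iff_psd_slack)

section \<open>Weak and strong duality\<close>

lemma upper_right_zero: "upper_right 0 = 0"
  by (simp add: upper_right_def vec_eq_iff)

lemma outer_tensor_zero_right: "outer_tensor x 0 = 0"
  by (simp add: outer_tensor_def vec_eq_iff)

lemma outer_tensor_comb:
  "outer_tensor x (upper_right (c *\<^sub>R L + c' *\<^sub>R L')) =
    c *\<^sub>R outer_tensor x (upper_right L) + c' *\<^sub>R outer_tensor x (upper_right L')"
  by (simp add: outer_tensor_def upper_right_def vec_eq_iff algebra_simps)

lemma trace_scaleR: "trace (c *\<^sub>R (L :: real^'k::finite^'k)) = c * trace L"
  by (simp add: trace_def sum_distrib_left)

lemma trace_zero: "trace (0 :: real^'k::finite^'k) = 0"
  by (simp add: trace_def)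

lemma measure_op_comb: "measure_op A (c *\<^sub>R T + c' *\<^sub>R T') = c *\<^sub>R measure_op A T + c' *\<^sub>R measure_op A T'"
  by (simp add: measure_op_def vec_eq_iff inner_add_right)

definition superpose :: "(real^'n1::finite) set \<Rightarrow> (real^'n1 \<Rightarrow> real^('n2 + 'n3)^('n2::finite + 'n3::finite)) \<Rightarrow>
    real^'n3^'n2^'n1" where
  "superpose \<Theta> \<Lambda> = (\<Sum>x\<in>\<Theta>. outer_tensor x (upper_right (\<Lambda> x)))"

lemma inner_superpose: "Z \<bullet> superpose \<Theta> \<Lambda> = (\<Sum>x\<in>\<Theta>. slice_comb Z x \<bullet> upper_right (\<Lambda> x))"
  by (simp add: superpose_def inner_sum_right inner_outer_tensor)

lemma superpose_mono_neutral:
  assumes "finite \<Theta>'" "\<Theta> \<subseteq> \<Theta>'" "\<And>x. x \<notin> \<Theta> \<Longrightarrow> \<Lambda> x = 0"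
  shows "superpose \<Theta>' \<Lambda> = superpose \<Theta> \<Lambda>" "half_trace_sum \<Theta>' \<Lambda> = half_trace_sum \<Theta> \<Lambda>"
  using assms
  by (auto simp: superpose_def half_trace_sum_def upper_right_zero outer_tensor_zero_right trace_zero
      intro!: sum.mono_neutral_right)

lemma superpose_comb:
  "superpose \<Theta> (\<lambda>x. c *\<^sub>R \<Lambda> x + c' *\<^sub>R \<Lambda>' x) = c *\<^sub>R superpose \<Theta> \<Lambda> + c' *\<^sub>R superpose \<Theta> \<Lambda>'"
  by (simp add: superpose_def outer_tensor_comb sum.distrib scaleR_sum_right)

lemma half_trace_sum_comb:
  "half_trace_sum \<Theta> (\<lambda>x. c *\<^sub>R \<Lambda> x + c' *\<^sub>R \<Lambda>' x) = c * half_trace_sum \<Theta> \<Lambda> + c' * half_trace_sum \<Theta> \<Lambda>'"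
  by (simp add: half_trace_sum_def trace_add trace_scaleR sum.distrib sum_distrib_left algebra_simps)

text \<open>The gap is the sum of \<open>slack (slice_comb Z x) \<bullet> \<Lambda> x\<close>, whose
  terms are nonnegative by self-duality. With \<open>\<Theta>\<close> an arbitrary subset of
  \<open>X\<close> this covers the fixed support as well as every support in the sphere.\<close>

lemma weak_duality:
  assumes "(\<mu>, Z) \<in> dual_feasible A X" "\<Theta> \<subseteq> X" "\<forall>x\<in>\<Theta>. psd (\<Lambda> x)"
    and "measure_op A (superpose \<Theta> \<Lambda>) = b"
  shows "\<mu> \<bullet> b \<le> half_trace_sum \<Theta> \<Lambda>"
proof -
  have "\<mu> \<bullet> b = Z \<bullet> superpose \<Theta> \<Lambda>"
    using assms(1,4) by (simp add: dual_feasible_iff inner_multiplier_comb)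
  also have "\<dots> \<le> (\<Sum>x\<in>\<Theta>. (1/2) * trace (\<Lambda> x))"
    unfolding inner_superpose
  proof (rule sum_mono)
    fix x assume x: "x \<in> \<Theta>"
    then have "0 \<le> slack (slice_comb Z x) \<bullet> \<Lambda> x"
      using assms by (auto simp: dual_feasible_iff intro!: psd_inner_nonneg)
    moreover have "transpose (\<Lambda> x) = \<Lambda> x" using x assms(3) by (simp add: psd_def)
    ultimately show "slice_comb Z x \<bullet> upper_right (\<Lambda> x) \<le> (1/2) * trace (\<Lambda> x)"
      by (simp add: inner_slack)
  qed
  finally show ?thesis by (simp add: half_trace_sum_def sum_distrib_left)
qed

text \<open>Families vanish outside \<open>\<Theta>\<close> so that supports can be enlarged freely.\<close>

definition attainable ::
  "('d \<Rightarrow> real^'n3::finite^'n2::finite^'n1::finite) \<Rightarrow> (real^'n1) set \<Rightarrow> real \<Rightarrow> (real^'d::finite) set" where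
  "attainable A X s = {y. \<exists>\<Theta> \<Lambda>. finite \<Theta> \<and> \<Theta> \<subseteq> X \<and> (\<forall>x. psd (\<Lambda> x)) \<and> (\<forall>x. x \<notin> \<Theta> \<longrightarrow> \<Lambda> x = 0) \<and>
     half_trace_sum \<Theta> \<Lambda> \<le> s \<and> measure_op A (superpose \<Theta> \<Lambda>) = y}"

lemma zero_attainable: "0 \<le> s \<Longrightarrow> 0 \<in> attainable A X s"
  by (auto simp: attainable_def superpose_def half_trace_sum_def measure_op_def vec_eq_iff
      intro!: exI [of _ "{}"] exI [of _ "\<lambda>_. 0"] psd_zero)

text \<open>On the union of the supports, cost and measurement are linear in the family. The case
  \<open>c + c' = 1\<close> gives convexity, the case \<open>c' = 0\<close> rescaling.\<close>

lemma attainable_comb: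
  assumes "y \<in> attainable A X s" "y' \<in> attainable A X s'" "0 \<le> c" "0 \<le> c'"
  shows "c *\<^sub>R y + c' *\<^sub>R y' \<in> attainable A X (c * s + c' * s')"
proof -
  obtain \<Theta> \<Lambda> where 1: "finite \<Theta>" "\<Theta> \<subseteq> X" "\<And>x. psd (\<Lambda> x)" "\<And>x. x \<notin> \<Theta> \<Longrightarrow> \<Lambda> x = 0"
    "half_trace_sum \<Theta> \<Lambda> \<le> s" "measure_op A (superpose \<Theta> \<Lambda>) = y"
    using assms(1) unfolding attainable_def by blast
  obtain \<Theta>' \<Lambda>' where 2: "finite \<Theta>'" "\<Theta>' \<subseteq> X" "\<And>x. psd (\<Lambda>' x)" "\<And>x. x \<notin> \<Theta>' \<Longrightarrow> \<Lambda>' x = 0"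
    "half_trace_sum \<Theta>' \<Lambda>' \<le> s'" "measure_op A (superpose \<Theta>' \<Lambda>') = y'"
    using assms(2) unfolding attainable_def by blast
  have fin: "finite (\<Theta> \<union> \<Theta>')" using 1 2 by simp
  note ext1 = superpose_mono_neutral [OF fin Un_upper1 1(4)]
  note ext2 = superpose_mono_neutral [OF fin Un_upper2 2(4)]
  let ?L = "\<lambda>x. c *\<^sub>R \<Lambda> x + c' *\<^sub>R \<Lambda>' x"
  have "half_trace_sum (\<Theta> \<union> \<Theta>') ?L \<le> c * s + c' * s'"
    using 1 2 assms(3,4) by (simp add: half_trace_sum_comb ext1 ext2 add_mono mult_left_mono)
  moreover have "measure_op A (superpose (\<Theta> \<union> \<Theta>') ?L) = c *\<^sub>R y + c' *\<^sub>R y'"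
    using 1 2 by (simp add: superpose_comb measure_op_comb ext1 ext2)
  moreover have "psd (?L x)" for x
    using 1 2 assms(3,4) by (intro psd_add psd_scaleR)
  moreover have "?L x = 0" if "x \<notin> \<Theta> \<union> \<Theta>'" for x
    using 1 2 that by simp
  ultimately show ?thesis
    unfolding attainable_def using fin 1(2) 2(2)
    by (intro CollectI exI [of _ "\<Theta> \<union> \<Theta>'"] exI [of _ ?L]) auto
qed

section \<open>Atoms, separation and strong duality\<close>

definition atoms ::
  "('d \<Rightarrow> real^'n3::finite^'n2::finite^'n1::finite) \<Rightarrow> (real^'n1) set \<Rightarrow> (real^'d::finite) set" where
  "atoms A X = (\<lambda>(x, u, v). measure_op A (outer_tensor x (\<chi> i j. u $ i * v $ j))) `
     (X \<times> sphere 0 1 \<times> sphere 0 1)"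

lemma compact_atoms: "compact X \<Longrightarrow> compact (atoms A X)"
  unfolding atoms_def measure_op_def outer_tensor_def case_prod_unfold
  by (intro compact_continuous_image continuous_intros compact_Times compact_sphere)

lemma atoms_subset_attainable: "atoms A X \<subseteq> attainable A X 1"
proof
  fix y assume "y \<in> atoms A X"
  then obtain x u v where x: "x \<in> X" and uv: "norm u = 1" "norm v = 1"
    and y: "y = measure_op A (outer_tensor x (\<chi> i j. u $ i * v $ j))"
    by (auto simp: atoms_def)
  let ?L = "\<lambda>z. if z = x then rank_one (join u v) else 0"
  have "half_trace_sum {x} ?L = 1"
    using uv by (simp add: half_trace_sum_def trace_rank_one inner_join norm_eq_1)
  moreover have "measure_op A (superpose {x} ?L) = y"
    by (simp add: y superpose_def upper_right_rank_one_join)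
  ultimately show "y \<in> attainable A X 1"
    unfolding attainable_def using x
    by (intro CollectI exI [of _ "{x}"] exI [of _ ?L]) (simp add: psd_rank_one psd_zero)
qed

text \<open>By the adjoint identities, \<open>u \<bullet> (slice_comb Z x *v v)\<close> is
  \<open>\<mu>\<close> paired with an atom, so the bound on atoms is the bound on unit vectors that
  makes \<open>slack\<close> psd.\<close>

lemma dual_feasible_if_atoms_le_1:
  fixes A :: "'d::finite \<Rightarrow> real^'n3::finite^'n2::finite^'n1::finite"
  assumes "\<And>y. y \<in> atoms A X \<Longrightarrow> \<mu> \<bullet> y \<le> 1"
  shows "(\<mu>, \<Sum>l\<in>UNIV. \<mu> $ l *\<^sub>R A l) \<in> dual_feasible A X"
  unfolding dual_feasible_iff
proof (intro conjI ballI refl psd_slack_if_bounded)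
  fix x and u :: "real^'n2" and v :: "real^'n3"
  assume x: "x \<in> X" and uv: "norm u = 1" "norm v = 1"
  let ?Z = "\<Sum>l\<in>UNIV. \<mu> $ l *\<^sub>R A l"
  have "u \<bullet> (slice_comb ?Z x *v v) = ?Z \<bullet> outer_tensor x (\<chi> i j. u $ i * v $ j)"
    by (simp add: inner_outer_tensor inner_outer)
  also have "\<dots> = \<mu> \<bullet> measure_op A (outer_tensor x (\<chi> i j. u $ i * v $ j))"
    by (rule inner_multiplier_comb)
  also have "\<dots> \<le> 1"
    using x uv by (intro assms) (force simp: atoms_def)
  finally show "u \<bullet> (slice_comb ?Z x *v v) \<le> 1" .
qed

text \<open>A hyperplane strictly separating \<open>b /\<^sub>R t\<close> from the compact hull
  would normalise to a dual feasible point with objective above \<open>t\<close>. Adding 0 to the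
  atoms makes the offset negative, hence usable for the normalisation.\<close>

lemma scaled_mem_hull_atoms:
  assumes "compact X" "0 < t" "\<And>\<mu> Z. (\<mu>, Z) \<in> dual_feasible A X \<Longrightarrow> \<mu> \<bullet> b \<le> t"
  shows "b /\<^sub>R t \<in> convex hull (insert 0 (atoms A X))" (is "_ \<in> ?K")
proof (rule ccontr)
  assume "b /\<^sub>R t \<notin> ?K"
  moreover have "closed ?K"
    using assms(1) by (intro compact_imp_closed compact_convex_hull compact_insert compact_atoms)
  ultimately obtain a \<beta> where a: "a \<bullet> (b /\<^sub>R t) < \<beta>" "\<And>y. y \<in> ?K \<Longrightarrow> \<beta> < a \<bullet> y"
    using separating_hyperplane_closed_point [OF convex_convex_hull] by blast
  have K: "insert 0 (atoms A X) \<subseteq> ?K" by (rule hull_subset)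
  then have \<beta>: "\<beta> < 0" using a(2) [of 0] by auto
  \<comment> \<open>Dividing by the negative \<open>\<beta>\<close> reverses both inequalities:
    \<open>\<mu>\<close> is below 1 on the atoms and above 1 at
    \<open>b /\<^sub>R t\<close>.\<close>
  define \<mu> where "\<mu> = a /\<^sub>R \<beta>"
  have "(\<mu>, \<Sum>l\<in>UNIV. \<mu> $ l *\<^sub>R A l) \<in> dual_feasible A X"
  proof (rule dual_feasible_if_atoms_le_1)
    fix y assume "y \<in> atoms A X"
    then have "\<beta> < a \<bullet> y" using K by (intro a(2)) auto
    then show "\<mu> \<bullet> y \<le> 1" using \<beta> by (simp add: \<mu>_def field_simps)
  qed
  then have "\<mu> \<bullet> b \<le> t" by (rule assms(3))
  moreover have "t < \<mu> \<bullet> b"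
    using a(1) \<beta> assms(2) by (simp add: \<mu>_def field_simps)
  ultimately show False by simp
qed

lemma strong_duality:
  assumes "compact X" "0 \<le> t" "\<And>\<mu> Z. (\<mu>, Z) \<in> dual_feasible A X \<Longrightarrow> \<mu> \<bullet> b \<le> t"
  shows "b \<in> attainable A X t"
proof (cases "t = 0")
  case True
  \<comment> \<open>Here \<open>b\<close> cannot be divided by \<open>t\<close>. Instead every
    \<open>s > 0\<close> also bounds the dual, so \<open>b\<close> lies in arbitrarily small
    multiples of a bounded set and must be 0.\<close>
  let ?K = "convex hull (insert 0 (atoms A X))"
  have "bounded ?K"
    using assms(1) by (intro compact_imp_bounded compact_convex_hull compact_insert compact_atoms)
  then obtain B where B: "\<And>y. y \<in> ?K \<Longrightarrow> norm y \<le> B" by (auto simp: bounded_iff)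
  have le: "norm b \<le> s * B" if "0 < s" for s
  proof -
    have "b /\<^sub>R s \<in> ?K"
      using assms True that by (intro scaled_mem_hull_atoms) force+
    then show ?thesis using B [of "b /\<^sub>R s"] that by (simp add: field_simps)
  qed
  have "b = 0"
  proof (rule ccontr)
    assume "b \<noteq> 0"
    then have nb: "0 < norm b" by simp
    have "0 < B" using le [of 1] nb by linarith
    \<comment> \<open>For this \<open>s\<close> the bound reads
      \<open>norm b \<le> norm b / 2\<close>.\<close>
    then show False using le [of "norm b / (2 * B)"] nb by simp
  qed
  then show ?thesis using zero_attainable assms(2) by simp
next
  case False
  then have t: "0 < t" using assms(2) by simp
  have "insert 0 (atoms A X) \<subseteq> attainable A X 1"
    using atoms_subset_attainable zero_attainable [of 1] by auto
  moreover have "convex (attainable A X 1)"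
    unfolding convex_def
  proof (intro ballI allI impI)
    fix y z and u v :: real
    assume *: "y \<in> attainable A X 1" "z \<in> attainable A X 1" "0 \<le> u" "0 \<le> v" "u + v = 1"
    show "u *\<^sub>R y + v *\<^sub>R z \<in> attainable A X 1"
      using attainable_comb [OF *(1-4)] *(5) by simp
  qed
  ultimately have "convex hull (insert 0 (atoms A X)) \<subseteq> attainable A X 1" by (rule hull_minimal)
  then have "b /\<^sub>R t \<in> attainable A X 1"
    using scaled_mem_hull_atoms [OF assms(1) t, of A b] assms(3) by blast
  \<comment> \<open>Rescales by \<open>t\<close>: coefficient \<open>t\<close> on a point of cost 1,
    coefficient 0 on the point 0.\<close>
  from attainable_comb [OF this zero_attainable [of 0], of t 0] show ?thesis using t by simp
qed

section \<open>Dual values and primal attainment\<close>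

lemma zero_dual_feasible: "(0, 0) \<in> dual_feasible A X"
  by (simp add: dual_feasible_iff psd_slack_iff slice_comb_def)

lemma dual_feasible_le_val: "(\<mu>, Z) \<in> dual_feasible A X \<Longrightarrow> ereal (\<mu> \<bullet> b) \<le> dual_val A b X"
  unfolding dual_val_def by (rule SUP_upper2) auto

lemma dual_val_nonneg: "0 \<le> dual_val A b X"
  using dual_feasible_le_val [OF zero_dual_feasible, of b] by (simp add: zero_ereal_def)

lemma dual_val_antimono: "X \<subseteq> Y \<Longrightarrow> dual_val A b Y \<le> dual_val A b X"
  unfolding dual_val_def by (rule SUP_subset_mono) (fastforce simp: dual_feasible_iff)+

lemma dual_val_le_half_trace_sum:
  assumes "\<Theta> \<subseteq> X" "\<forall>x\<in>\<Theta>. psd (\<Lambda> x)" "measure_op A (superpose \<Theta> \<Lambda>) = b"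
  shows "dual_val A b X \<le> ereal (half_trace_sum \<Theta> \<Lambda>)"
  unfolding dual_val_def using weak_duality [OF _ assms] by (auto intro!: SUP_least)

lemma dual_val_attainable:
  assumes "compact X" "dual_val A b X = ereal t"
  shows "b \<in> attainable A X t"
proof (rule strong_duality [OF assms(1)])
  show "0 \<le> t" using dual_val_nonneg [of A b X] assms(2) by simp
  show "\<mu> \<bullet> b \<le> t" if "(\<mu>, Z) \<in> dual_feasible A X" for \<mu> Z
    using dual_feasible_le_val [OF that, of b] assms(2) by simp
qed

lemma primal_D_feasible_iff:
  "(T, \<Lambda>) \<in> primal_D_feasible A b \<Upsilon> \<longleftrightarrow>
    (\<forall>x\<in>\<Upsilon>. psd (\<Lambda> x)) \<and> T = superpose \<Upsilon> \<Lambda> \<and> measure_op A T = b"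
  by (simp add: primal_D_feasible_def superpose_def)

lemma primal_feasible_iff:
  "(T, \<Theta>, \<Lambda>) \<in> primal_feasible A b \<longleftrightarrow> finite \<Theta> \<and> \<Theta> \<subseteq> sphere 0 1 \<and>
    (\<forall>x\<in>\<Theta>. psd (\<Lambda> x)) \<and> T = superpose \<Theta> \<Lambda> \<and> measure_op A T = b"
  by (simp add: primal_feasible_def superpose_def)

text \<open>Strong duality may yield a smaller support. Extending by the psd matrix 0 puts the
  family on all of \<open>\<Upsilon>\<close>, as PRIMAL(D) and the condition on supports in (ii)
  demand.\<close>

lemma dual_val_attained_on_finite:
  assumes "finite \<Upsilon>" "dual_val A b \<Upsilon> = ereal t"
  obtains \<Lambda> where "\<And>x. psd (\<Lambda> x)" "half_trace_sum \<Upsilon> \<Lambda> \<le> t" "measure_op A (superpose \<Upsilon> \<Lambda>) = b"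
proof -
  obtain \<Theta> \<Lambda> where *: "\<Theta> \<subseteq> \<Upsilon>" "\<And>x. psd (\<Lambda> x)" "\<And>x. x \<notin> \<Theta> \<Longrightarrow> \<Lambda> x = 0"
    "half_trace_sum \<Theta> \<Lambda> \<le> t" "measure_op A (superpose \<Theta> \<Lambda>) = b"
    using dual_val_attainable [OF finite_imp_compact [OF assms(1)] assms(2)]
    unfolding attainable_def by blast
  with superpose_mono_neutral [OF assms(1) *(1,3)] show thesis by (intro that [of \<Lambda>]) auto
qed

lemma primal_D_val_eq_dual_val:
  assumes "finite \<Upsilon>"
  shows "primal_D_val A b \<Upsilon> = dual_val A b \<Upsilon>"
proof (rule antisym)
  show "dual_val A b \<Upsilon> \<le> primal_D_val A b \<Upsilon>"
    unfolding primal_D_val_def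
    by (rule INF_greatest) (auto simp: primal_D_feasible_iff intro!: dual_val_le_half_trace_sum)
  show "primal_D_val A b \<Upsilon> \<le> dual_val A b \<Upsilon>"
  proof (cases "dual_val A b \<Upsilon>")
    case (real t)
    then obtain \<Lambda> where *: "\<And>x. psd (\<Lambda> x)" "half_trace_sum \<Upsilon> \<Lambda> \<le> t" "measure_op A (superpose \<Upsilon> \<Lambda>) = b"
      using dual_val_attained_on_finite [OF assms] by metis
    then have "(superpose \<Upsilon> \<Lambda>, \<Lambda>) \<in> primal_D_feasible A b \<Upsilon>"
      by (simp add: primal_D_feasible_iff)
    then have "primal_D_val A b \<Upsilon> \<le> ereal (half_trace_sum \<Upsilon> \<Lambda>)"
      unfolding primal_D_val_def by (rule INF_lower2) auto
    then show ?thesis using *(2) real by (metis ereal_less_eq(3) order_trans)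
  \<comment> \<open>The value \<infinity> is a trivial upper bound, and -\<infinity> is excluded by
    nonnegativity.\<close>
  qed (use dual_val_nonneg [of A b \<Upsilon>] in auto)
qed

text \<open>The sphere contains the basis vectors, at which \<open>slice_comb Z\<close> returns the
  slices of \<open>Z\<close>. So the entries of \<open>Z\<close> are bounded by 1 and
  \<open>\<mu> \<bullet> b = Z \<bullet> T\<close> by the entrywise sum of absolute values of
  \<open>T\<close>.\<close>

lemma dual_val_sphere_finite:
  assumes "measure_op A T = b"
  obtains t where "dual_val A b (sphere 0 1) = ereal t"
proof -
  let ?B = "\<Sum>i\<in>UNIV. \<Sum>j\<in>UNIV. \<Sum>k\<in>UNIV. \<bar>T $ i $ j $ k\<bar>"
  have "\<mu> \<bullet> b \<le> ?B" if "(\<mu>, Z) \<in> dual_feasible A (sphere 0 1)" for \<mu> Z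
  proof -
    have "psd (slack (slice_comb Z (axis i 1)))" for i
      using that unfolding dual_feasible_iff by (elim conjE bspec) simp
    moreover have "slice_comb Z (axis i 1) = Z $ i" for i
    proof -
      have "slice_comb Z (axis i 1) = (\<Sum>j\<in>UNIV. if j = i then Z $ j else 0)"
        unfolding slice_comb_def by (intro sum.cong) (auto simp: axis_def)
      then show ?thesis by simp
    qed
    ultimately have entry: "\<bar>Z $ i $ j $ k\<bar> \<le> 1" for i j k
      using psd_slack_entry by metis
    have "\<mu> \<bullet> b = Z \<bullet> T"
      using that assms by (simp add: dual_feasible_iff inner_multiplier_comb)
    also have "\<dots> = (\<Sum>i\<in>UNIV. \<Sum>j\<in>UNIV. \<Sum>k\<in>UNIV. Z $ i $ j $ k * T $ i $ j $ k)"
      by (simp add: inner_vec_def)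
    also have "\<dots> \<le> ?B"
    proof (intro sum_mono)
      fix i j k
      have "Z $ i $ j $ k * T $ i $ j $ k \<le> \<bar>Z $ i $ j $ k\<bar> * \<bar>T $ i $ j $ k\<bar>"
        by (metis abs_ge_self abs_mult)
      also have "\<dots> \<le> \<bar>T $ i $ j $ k\<bar>"
        using entry by (simp add: mult_left_le_one_le)
      finally show "Z $ i $ j $ k * T $ i $ j $ k \<le> \<bar>T $ i $ j $ k\<bar>" .
    qed
    finally show ?thesis .
  qed
  then have "dual_val A b (sphere 0 1) \<le> ereal ?B"
    unfolding dual_val_def by (auto intro!: SUP_least)
  then show thesis
    using dual_val_nonneg [of A b "sphere 0 1"] that by (cases "dual_val A b (sphere 0 1)") auto
qed

section \<open>The Lagrangian dual\<close>

text \<open>Sorted by primal variable: the coefficients of \<open>T\<close> and of each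
  \<open>\<Lambda> x\<close> are the residuals of the stationarity conditions.\<close>

lemma lagrangian_D_eq:
  assumes "\<forall>x\<in>\<Upsilon>. transpose (\<Lambda> x) = \<Lambda> x"
  shows "lagrangian_D A b \<Upsilon> T \<Lambda> \<mu> Z S =
    \<mu> \<bullet> b + (Z - (\<Sum>l\<in>UNIV. \<mu> $ l *\<^sub>R A l)) \<bullet> T
      + (\<Sum>x\<in>\<Upsilon>. (slack (slice_comb Z x) - S x) \<bullet> \<Lambda> x)"
proof -
  have "(\<Sum>x\<in>\<Upsilon>. slack (slice_comb Z x) \<bullet> \<Lambda> x) =
      (\<Sum>x\<in>\<Upsilon>. (1/2) * trace (\<Lambda> x) - slice_comb Z x \<bullet> upper_right (\<Lambda> x))"
    using assms by (intro sum.cong) (auto simp: inner_slack)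
  also have "\<dots> = half_trace_sum \<Upsilon> \<Lambda> - Z \<bullet> superpose \<Upsilon> \<Lambda>"
    by (simp add: sum_subtractf half_trace_sum_def sum_distrib_left inner_superpose)
  finally show ?thesis
    by (simp add: lagrangian_D_def superpose_def inner_diff_left inner_diff_right
        inner_multiplier_comb sum_subtractf)
qed

lemma lagrange_dual_fun_D_eq:
  assumes "Z = (\<Sum>l\<in>UNIV. \<mu> $ l *\<^sub>R A l)" "\<And>x. x \<in> \<Upsilon> \<Longrightarrow> S x = slack (slice_comb Z x)"
  shows "lagrange_dual_fun_D A b \<Upsilon> \<mu> Z S = ereal (\<mu> \<bullet> b)"
proof -
  have eq: "lagrangian_D A b \<Upsilon> T \<Lambda> \<mu> Z S = \<mu> \<bullet> b" if "\<forall>x\<in>\<Upsilon>. transpose (\<Lambda> x) = \<Lambda> x" for T \<Lambda>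
    using assms(2) by (simp add: lagrangian_D_eq [OF that] assms(1))
  show ?thesis
  proof (rule antisym)
    show "lagrange_dual_fun_D A b \<Upsilon> \<mu> Z S \<le> ereal (\<mu> \<bullet> b)"
      unfolding lagrange_dual_fun_D_def
      \<comment> \<open>The Lagrangian is constant on symmetric families, so any of them bounds the
        infimum; zero is the simplest.\<close>
      by (rule INF_lower2 [of "(0, \<lambda>_. 0)"]) (auto simp: eq transpose_def vec_eq_iff)
    show "ereal (\<mu> \<bullet> b) \<le> lagrange_dual_fun_D A b \<Upsilon> \<mu> Z S"
      unfolding lagrange_dual_fun_D_def by (rule INF_greatest) (auto simp: eq)
  qed
qed

text \<open>The Lagrangian is affine in \<open>(T, \<Lambda>)\<close>; moving against its gradient drives it to minus
  infinity unless the gradient vanishes.\<close>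

lemma lagrange_dual_fun_D_finite:
  assumes "finite \<Upsilon>" "\<forall>x\<in>\<Upsilon>. psd (S x)" "lagrange_dual_fun_D A b \<Upsilon> \<mu> Z S \<noteq> -\<infinity>"
  shows "Z = (\<Sum>l\<in>UNIV. \<mu> $ l *\<^sub>R A l)" "\<And>x. x \<in> \<Upsilon> \<Longrightarrow> S x = slack (slice_comb Z x)"
proof -
  define D where "D = Z - (\<Sum>l\<in>UNIV. \<mu> $ l *\<^sub>R A l)"
  define E where "E x = slack (slice_comb Z x) - S x" for x
  obtain c where c: "ereal c \<le> lagrange_dual_fun_D A b \<Upsilon> \<mu> Z S"
    using assms(3) by (cases "lagrange_dual_fun_D A b \<Upsilon> \<mu> Z S") auto
  \<comment> \<open>Symmetry of \<open>S x\<close> makes the multiples of \<open>E\<close>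
    admissible in the infimum.\<close>
  have "transpose (S x) = S x" if "x \<in> \<Upsilon>" for x
    using assms(2) that by (simp add: psd_def)
  then have sym: "transpose (k *\<^sub>R E x) = k *\<^sub>R E x" if "x \<in> \<Upsilon>" for k x
    using that transpose_slack [of "slice_comb Z x"] by (simp add: E_def transpose_def vec_eq_iff)
  \<comment> \<open>Along \<open>k\<close> times the gradient the slope in \<open>k\<close> is the
    squared norm of the gradient; a lower bound valid for all real \<open>k\<close> forces it to be
    0.\<close>
  have "0 \<le> (\<mu> \<bullet> b - c) + k * (D \<bullet> D + (\<Sum>x\<in>\<Upsilon>. E x \<bullet> E x))" for k
  proof -
    have "lagrange_dual_fun_D A b \<Upsilon> \<mu> Z S \<le> ereal (lagrangian_D A b \<Upsilon> (k *\<^sub>R D) (\<lambda>x. k *\<^sub>R E x) \<mu> Z S)"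
      unfolding lagrange_dual_fun_D_def
      by (rule INF_lower2 [of "(k *\<^sub>R D, \<lambda>x. k *\<^sub>R E x)"]) (auto simp: sym)
    from order_trans [OF c this] have "c \<le> lagrangian_D A b \<Upsilon> (k *\<^sub>R D) (\<lambda>x. k *\<^sub>R E x) \<mu> Z S"
      by simp
    also have "\<dots> = \<mu> \<bullet> b + k * (D \<bullet> D + (\<Sum>x\<in>\<Upsilon>. E x \<bullet> E x))"
      using sym by (simp add: lagrangian_D_eq D_def [symmetric] E_def [symmetric]
          distrib_left sum_distrib_left)
    finally show ?thesis by simp
  qed
  then have "D \<bullet> D + (\<Sum>x\<in>\<Upsilon>. E x \<bullet> E x) = 0" by (rule affine_nonneg_slope_zero)
  moreover have "0 \<le> D \<bullet> D" "0 \<le> (\<Sum>x\<in>\<Upsilon>. E x \<bullet> E x)" by (auto intro: sum_nonneg)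
  ultimately have "D \<bullet> D = 0" "(\<Sum>x\<in>\<Upsilon>. E x \<bullet> E x) = 0" by linarith+
  then have "D = 0" "\<And>x. x \<in> \<Upsilon> \<Longrightarrow> E x = 0"
    using assms(1) by (auto simp: sum_nonneg_eq_0_iff)
  then show "Z = (\<Sum>l\<in>UNIV. \<mu> $ l *\<^sub>R A l)" "\<And>x. x \<in> \<Upsilon> \<Longrightarrow> S x = slack (slice_comb Z x)"
    by (auto simp: D_def E_def)
qed

text \<open>Stationarity determines \<open>S\<close> on \<open>\<Upsilon>\<close>, and its sign
  constraint then becomes the semidefinite constraint of DUAL(D).\<close>

lemma lagrange_dual_feasible_D_iff:
  assumes "finite \<Upsilon>"
  shows "(\<mu>, Z, S) \<in> lagrange_dual_feasible_D A b \<Upsilon> \<longleftrightarrow>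
    (\<mu>, Z) \<in> dual_feasible A \<Upsilon> \<and> (\<forall>x\<in>\<Upsilon>. S x = slack (slice_comb Z x))" (is "?L \<longleftrightarrow> ?R")
proof
  assume ?L
  then have psd: "\<forall>x\<in>\<Upsilon>. psd (S x)" and fin: "lagrange_dual_fun_D A b \<Upsilon> \<mu> Z S \<noteq> -\<infinity>"
    by (auto simp: lagrange_dual_feasible_D_def)
  note vals = lagrange_dual_fun_D_finite [OF assms psd fin]
  have "\<forall>x\<in>\<Upsilon>. psd (slack (slice_comb Z x))"
    using psd vals(2) by simp
  then show ?R
    using vals unfolding dual_feasible_iff by blast
next
  assume ?R
  then have psd: "\<forall>x\<in>\<Upsilon>. psd (slack (slice_comb Z x))" and Z: "Z = (\<Sum>l\<in>UNIV. \<mu> $ l *\<^sub>R A l)"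
    and S: "\<And>x. x \<in> \<Upsilon> \<Longrightarrow> S x = slack (slice_comb Z x)"
    unfolding dual_feasible_iff by blast+
  have "\<forall>x\<in>\<Upsilon>. psd (S x)"
    using psd S by simp
  then show ?L
    using lagrange_dual_fun_D_eq [of Z \<mu> A \<Upsilon> S b, OF Z S]
    by (simp add: lagrange_dual_feasible_D_def)
qed

text \<open>Projecting away \<open>S\<close> loses nothing: on \<open>\<Upsilon>\<close> it is a
  function of \<open>Z\<close>, and each pair feasible for DUAL(D) lifts through
  \<open>slack\<close>.\<close>

lemma dual_D_is_lagrangian_dual_if_finite:
  fixes A :: "'d::finite \<Rightarrow> real^'n3::finite^'n2::finite^'n1::finite"
  assumes "finite \<Upsilon>"
  shows "dual_D_is_lagrangian_dual A b \<Upsilon>"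
  unfolding dual_D_is_lagrangian_dual_def
proof
  note iff = lagrange_dual_feasible_D_iff [OF assms]
  show "dual_feasible A \<Upsilon> = (\<lambda>(\<mu>, Z, S). (\<mu>, Z)) ` lagrange_dual_feasible_D A b \<Upsilon>"
  proof (rule set_eqI)
    fix p :: "(real^'d) \<times> (real^'n3^'n2^'n1)"
    obtain \<mu> Z where p: "p = (\<mu>, Z)" by fastforce
    have "p \<in> (\<lambda>(\<mu>, Z, S). (\<mu>, Z)) ` lagrange_dual_feasible_D A b \<Upsilon> \<longleftrightarrow>
        (\<exists>S. (\<mu>, Z, S) \<in> lagrange_dual_feasible_D A b \<Upsilon>)"
      by (force simp: p)
    then show "p \<in> dual_feasible A \<Upsilon> \<longleftrightarrow>
        p \<in> (\<lambda>(\<mu>, Z, S). (\<mu>, Z)) ` lagrange_dual_feasible_D A b \<Upsilon>"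
      by (auto simp: p iff)
  qed
  show "\<forall>(\<mu>, Z, S) \<in> lagrange_dual_feasible_D A b \<Upsilon>. lagrange_dual_fun_D A b \<Upsilon> \<mu> Z S = ereal (\<mu> \<bullet> b)"
    by (auto simp: iff dual_feasible_iff intro!: lagrange_dual_fun_D_eq)
qed

section \<open>Optimal primal solutions\<close>

text \<open>Weak duality on the sphere makes the dual value a lower bound for every support, and
  strong duality supplies a feasible point that reaches it.\<close>

lemma primal_optimal_iff_dual_val:
  assumes "measure_op A T\<^sub>0 = b"
  shows "primal_optimal A b (T, \<Theta>, \<Lambda>) \<longleftrightarrow>
    (T, \<Theta>, \<Lambda>) \<in> primal_feasible A b \<and> ereal (half_trace_sum \<Theta> \<Lambda>) = dual_val A b (sphere 0 1)"
proof -
  obtain t where t: "dual_val A b (sphere 0 1) = ereal t"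
    using dual_val_sphere_finite [OF assms] .
  have lower: "t \<le> half_trace_sum \<Theta>' \<Lambda>'" if "(T', \<Theta>', \<Lambda>') \<in> primal_feasible A b" for T' \<Theta>' \<Lambda>'
    using dual_val_le_half_trace_sum [of \<Theta>' "sphere 0 1" \<Lambda>' A b] that t
    by (auto simp: primal_feasible_iff)
  obtain \<Theta>\<^sub>1 \<Lambda>\<^sub>1 where "finite \<Theta>\<^sub>1" "\<Theta>\<^sub>1 \<subseteq> sphere 0 1" "\<forall>x. psd (\<Lambda>\<^sub>1 x)"
    "measure_op A (superpose \<Theta>\<^sub>1 \<Lambda>\<^sub>1) = b" and le: "half_trace_sum \<Theta>\<^sub>1 \<Lambda>\<^sub>1 \<le> t"
    using dual_val_attainable [OF compact_sphere t] unfolding attainable_def by blast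
  then have feas: "(superpose \<Theta>\<^sub>1 \<Lambda>\<^sub>1, \<Theta>\<^sub>1, \<Lambda>\<^sub>1) \<in> primal_feasible A b"
    by (simp add: primal_feasible_iff)
  have "primal_optimal A b (T, \<Theta>, \<Lambda>) \<longleftrightarrow> (T, \<Theta>, \<Lambda>) \<in> primal_feasible A b \<and>
      (\<forall>T' \<Theta>' \<Lambda>'. (T', \<Theta>', \<Lambda>') \<in> primal_feasible A b \<longrightarrow> half_trace_sum \<Theta> \<Lambda> \<le> half_trace_sum \<Theta>' \<Lambda>')"
    by (simp add: primal_optimal_def is_arg_min_linorder)
  also have "\<dots> \<longleftrightarrow> (T, \<Theta>, \<Lambda>) \<in> primal_feasible A b \<and> half_trace_sum \<Theta> \<Lambda> = t"
  proof (intro conj_cong refl iffI allI impI)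
    assume "(T, \<Theta>, \<Lambda>) \<in> primal_feasible A b"
      and "\<forall>T' \<Theta>' \<Lambda>'. (T', \<Theta>', \<Lambda>') \<in> primal_feasible A b \<longrightarrow> half_trace_sum \<Theta> \<Lambda> \<le> half_trace_sum \<Theta>' \<Lambda>'"
    then have "t \<le> half_trace_sum \<Theta> \<Lambda>" "half_trace_sum \<Theta> \<Lambda> \<le> half_trace_sum \<Theta>\<^sub>1 \<Lambda>\<^sub>1"
      using lower feas by blast+
    then show "half_trace_sum \<Theta> \<Lambda> = t" using le by simp
  qed (simp add: lower)
  finally show ?thesis by (simp add: t)
qed

theorem theorem4:
  fixes A :: "'d::finite \<Rightarrow> real^'n3::finite^'n2::finite^'n1::finite"
    and b :: "real^'d"
    and \<Upsilon> :: "(real^'n1) set"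
  assumes "inj A" and "independent (range A)"
    and "{T. measure_op A T = b} \<noteq> {}"
    and "finite \<Upsilon>" and "\<Upsilon> \<subseteq> sphere 0 1"
  shows "(dual_D_is_lagrangian_dual A b \<Upsilon> \<and> primal_D_val A b \<Upsilon> = dual_val A b \<Upsilon>) \<and>
    (dual_val A b (sphere 0 1) = dual_val A b \<Upsilon> \<longleftrightarrow>
      (\<exists>T \<Theta> \<Lambda>. primal_optimal A b (T, \<Theta>, \<Lambda>) \<and> \<Upsilon> = \<Theta>))"
proof (intro conjI)
  obtain T\<^sub>0 where T\<^sub>0: "measure_op A T\<^sub>0 = b" using assms(3) by blast
  note optimal_iff = primal_optimal_iff_dual_val [OF T\<^sub>0]
  show "dual_val A b (sphere 0 1) = dual_val A b \<Upsilon> \<longleftrightarrow>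
      (\<exists>T \<Theta> \<Lambda>. primal_optimal A b (T, \<Theta>, \<Lambda>) \<and> \<Upsilon> = \<Theta>)"
  proof
    assume eq: "dual_val A b (sphere 0 1) = dual_val A b \<Upsilon>"
    obtain t where t: "dual_val A b (sphere 0 1) = ereal t"
      using dual_val_sphere_finite [OF T\<^sub>0] .
    \<comment> \<open>The assumed equality makes the value of DUAL(D) finite, and a family on
      exactly \<open>\<Upsilon>\<close> attains it, hence attains the value of DUAL.\<close>
    obtain \<Lambda> where *: "\<And>x. psd (\<Lambda> x)" "half_trace_sum \<Upsilon> \<Lambda> \<le> t" "measure_op A (superpose \<Upsilon> \<Lambda>) = b"
      using dual_val_attained_on_finite [OF assms(4)] t eq by metis
    have "t \<le> half_trace_sum \<Upsilon> \<Lambda>"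
      using dual_val_le_half_trace_sum [of \<Upsilon> \<Upsilon> \<Lambda> A b] * t eq by simp
    then have "primal_optimal A b (superpose \<Upsilon> \<Lambda>, \<Upsilon>, \<Lambda>)"
      using * t assms(4,5) by (simp add: optimal_iff primal_feasible_iff)
    then show "\<exists>T \<Theta> \<Lambda>. primal_optimal A b (T, \<Theta>, \<Lambda>) \<and> \<Upsilon> = \<Theta>" by blast
  next
    assume "\<exists>T \<Theta> \<Lambda>. primal_optimal A b (T, \<Theta>, \<Lambda>) \<and> \<Upsilon> = \<Theta>"
    then obtain T \<Lambda> where "primal_optimal A b (T, \<Upsilon>, \<Lambda>)" by blast
    then have *: "(T, \<Upsilon>, \<Lambda>) \<in> primal_feasible A b"
      "ereal (half_trace_sum \<Upsilon> \<Lambda>) = dual_val A b (sphere 0 1)"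
      by (simp_all add: optimal_iff)
    \<comment> \<open>The optimal family is also feasible on \<open>\<Upsilon>\<close>, so its cost,
      the value of DUAL, bounds DUAL(D) from above; the reverse bound holds since DUAL(D) has fewer
      constraints.\<close>
    then have "dual_val A b \<Upsilon> \<le> ereal (half_trace_sum \<Upsilon> \<Lambda>)"
      by (intro dual_val_le_half_trace_sum) (auto simp: primal_feasible_iff)
    with *(2) dual_val_antimono [OF assms(5), of A b]
    show "dual_val A b (sphere 0 1) = dual_val A b \<Upsilon>" by simp
  qed
qed (use assms(4) in \<open>simp_all add: dual_D_is_lagrangian_dual_if_finite primal_D_val_eq_dual_val\<close>)

end
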